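(* Let $\mathcal Q(C_a,C_b)$ be a hypergraph product code with the logical Pauli operators given by SLT bases. For every logical qubit $(i,h,L)$ of the left sector, the single-qubit targeted logical Hadamard gate acting on the $(i,h,L)$-th logical qubit has the symplectic representation $$F^H_{i,h,L}=\begin{bmatrix}\tilde A&0&\tilde B&0\\0&I_{\tilde m}&0&0\\ \tilde C&0&\tilde D&0\\0&0&0&I_{\tilde m}\end{bmatrix}$$ (row and column blocks of sizes $\tilde n,\tilde m,\tilde n,\tilde m$), where $$\tilde A=I_{\tilde n}+(a_i\otimes e_h)^{\top}(e_i\otimes b_h),\quad \tilde B=(a_i\otimes e_h)^{\top}(a_i\otimes e_h),$$ $$\tilde C=(e_i\otimes b_h)^{\top}(e_i\otimes b_h),\quad \tilde D=I_{\tilde n}+(e_i\otimes b_h)^{\top}(a_i\otimes e_h).$$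
   Context: All vectors are row vectors over $\mathbb F_2$; $e_i$ denotes a standard basis vector of the appropriate length. Given binary matrices $H_a$ ($m_a\times n_a$) and $H_b$ ($m_b\times n_b$), parity-check matrices of classical codes $C_a=\ker H_a$, $C_b=\ker H_b$, the hypergraph product (HGP) code $\mathcal Q(C_a,C_b)$ is the CSS code on $n=\tilde n+\tilde m$ qubits, $\tilde n=n_an_b$, $\tilde m=m_am_b$, with $$H_X=[H_a\otimes I_{n_b}\,|\,I_{m_a}\otimes H_b^{\top}],\qquad H_Z=[I_{n_a}\otimes H_b\,|\,H_a^{\top}\otimes I_{m_b}].$$ The first $\tilde n$ qubits form the left sector, the last $\tilde m$ the right sector. Stabilizer generators correspond to the vectors $[H_X(r,:),0]$, $[0,H_Z(r,:)]$ in $\mathbb F_2^{2n}$, where $[a,b]$ represents up to phase the Pauli operator $X^{a_1}Z^{b_1}\otimes\cdots\otimes X^{a_n}Z^{b_n}$. An SLT basis of a subspace is a basis $\{a_i\}$ whose vectors are indexed by distinct coordinates $i$ (pivots) such that $(a_i)_i=1$ and $(a_{i'})_i=0$ for pivots $i'\ne i$. Let $\{a_i\},\{\alpha_j\},\{b_h\},\{\beta_l\}$ be SLT bases of $\ker H_a,\ker H_a^{\top},\ker H_b,\ker H_b^{\top}$. Logical qubits are labelled $(i,h,L)$ ($i$ a pivot of $\{a_i\}$, $h$ a pivot of $\{b_h\}$) and $(j,l,R)$ ($j$ a pivot of $\{\alpha_j\}$, $l$ a pivot of $\{\beta_l\}$). Logical Paulis: $\overline X_{i,h,L}$ is the $X$-type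 operator with vector $[\,e_i\otimes b_h\,|\,0\,]$, $\overline Z_{i,h,L}$ the $Z$-type operator with vector $[\,a_i\otimes e_h\,|\,0\,]$, $\overline X_{j,l,R}$ the $X$-type operator with vector $[\,0\,|\,\alpha_j\otimes e_l\,]$, $\overline Z_{j,l,R}$ the $Z$-type operator with vector $[\,0\,|\,e_j\otimes\beta_l\,]$. A matrix $F$ is a symplectic representation of a logical gate $g$ if $F\Omega F^{\top}=\Omega$ with $\Omega=\begin{bmatrix}0 & I_n \\ I_n & 0\end{bmatrix}$, right multiplication by $F$ fixes every stabilizer generator vector, and it maps the vectors in $\mathbb F_2^{2n}$ of the logical Paulis as $g$ prescribes modulo phases. The logical Hadamard gate on $(i,h,L)$ exchanges $\overline X_{i,h,L}$ and $\overline Z_{i,h,L}$ and fixes all other logical Paulis $\overline X,\overline Z$. *)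

theory Defs
  imports "Jordan_Normal_Form.Matrix_Kernel" "HOL-Library.Z2"
begin

definition kron_vec :: "'a :: semiring_0 vec \<Rightarrow> 'a vec \<Rightarrow> 'a vec" (infixl \<open>\<otimes>\<^sub>v\<close> 70) where
  "u \<otimes>\<^sub>v v = vec (dim_vec u * dim_vec v) (\<lambda>k. u $ (k div dim_vec v) * v $ (k mod dim_vec v))"

definition kron_mat :: "'a :: semiring_0 mat \<Rightarrow> 'a mat \<Rightarrow> 'a mat" (infixl \<open>\<otimes>\<^sub>m\<close> 70) where
  "A \<otimes>\<^sub>m B = mat (dim_row A * dim_row B) (dim_col A * dim_col B)
     (\<lambda>(r, c). A $$ (r div dim_row B, c div dim_col B) * B $$ (r mod dim_row B, c mod dim_col B))"

definition append_cols :: "'a :: zero mat \<Rightarrow> 'a mat \<Rightarrow> 'a mat" (infixr \<open>@\<^sub>c\<close> 65) where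
  "A @\<^sub>c B = (A\<^sup>T @\<^sub>r B\<^sup>T)\<^sup>T"

definition outer_prod :: "'a :: semiring_0 vec \<Rightarrow> 'a vec \<Rightarrow> 'a mat" where
  "outer_prod u v = (mat_of_row u)\<^sup>T * mat_of_row v"

text \<open>
  A family \<^term>\<open>a\<close> indexed by a set \<^term>\<open>P\<close> of pivots. Injectivity of \<^term>\<open>a\<close> on \<^term>\<open>P\<close>
  follows from the pivot condition, so that taking the image loses no multiplicities.
  Coordinates count from 0.
\<close>
definition is_SLT_basis :: "nat \<Rightarrow> bit vec set \<Rightarrow> nat set \<Rightarrow> (nat \<Rightarrow> bit vec) \<Rightarrow> bool" where
  "is_SLT_basis n W P a \<longleftrightarrow>
     P \<subseteq> {..<n} \<and>
     vectorspace.basis class_ring (module_vec TYPE(bit) n\<lparr>carrier := W\<rparr>) (a ` P) \<and>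
     (\<forall>i\<in>P. \<forall>i'\<in>P. a i $ i' = (if i' = i then 1 else 0))"

text \<open>
  The suffix \<open>t\<close> refers to the transposed check matrix: \<open>vec_at\<close> is the family \<open>\<alpha>\<close> and
  \<open>vec_bt\<close> the family \<open>\<beta>\<close>.
\<close>
record hgp =
  H_a :: "bit mat"
  H_b :: "bit mat"
  piv_a :: "nat set"
  vec_a :: "nat \<Rightarrow> bit vec"
  piv_at :: "nat set"
  vec_at :: "nat \<Rightarrow> bit vec"
  piv_b :: "nat set"
  vec_b :: "nat \<Rightarrow> bit vec"
  piv_bt :: "nat set"
  vec_bt :: "nat \<Rightarrow> bit vec"

definition has_SLT_bases :: "hgp \<Rightarrow> bool" where
  "has_SLT_bases Q \<longleftrightarrow>
     is_SLT_basis (dim_col (H_a Q)) (mat_kernel (H_a Q)) (piv_a Q) (vec_a Q) \<and>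
     is_SLT_basis (dim_row (H_a Q)) (mat_kernel (H_a Q)\<^sup>T) (piv_at Q) (vec_at Q) \<and>
     is_SLT_basis (dim_col (H_b Q)) (mat_kernel (H_b Q)) (piv_b Q) (vec_b Q) \<and>
     is_SLT_basis (dim_row (H_b Q)) (mat_kernel (H_b Q)\<^sup>T) (piv_bt Q) (vec_bt Q)"

definition n_left :: "hgp \<Rightarrow> nat" where
  "n_left Q = dim_col (H_a Q) * dim_col (H_b Q)"

definition n_right :: "hgp \<Rightarrow> nat" where
  "n_right Q = dim_row (H_a Q) * dim_row (H_b Q)"

definition n_qubits :: "hgp \<Rightarrow> nat" where
  "n_qubits Q = n_left Q + n_right Q"

definition H_X :: "hgp \<Rightarrow> bit mat" where
  "H_X Q = (H_a Q \<otimes>\<^sub>m 1\<^sub>m (dim_col (H_b Q))) @\<^sub>c (1\<^sub>m (dim_row (H_a Q)) \<otimes>\<^sub>m (H_b Q)\<^sup>T)"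

definition H_Z :: "hgp \<Rightarrow> bit mat" where
  "H_Z Q = (1\<^sub>m (dim_col (H_a Q)) \<otimes>\<^sub>m H_b Q) @\<^sub>c ((H_a Q)\<^sup>T \<otimes>\<^sub>m 1\<^sub>m (dim_row (H_b Q)))"

text \<open>
  A vector \<open>x @\<^sub>v z\<close> of length \<open>2 * n_qubits Q\<close> represents, up to phase, the Pauli operator with
  X-part \<open>x\<close> and Z-part \<open>z\<close>.
\<close>
definition X_type :: "hgp \<Rightarrow> bit vec \<Rightarrow> bit vec" where
  "X_type Q x = x @\<^sub>v 0\<^sub>v (n_qubits Q)"

definition Z_type :: "hgp \<Rightarrow> bit vec \<Rightarrow> bit vec" where
  "Z_type Q z = 0\<^sub>v (n_qubits Q) @\<^sub>v z"

definition stabilizer_generators :: "hgp \<Rightarrow> bit vec set" where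
  "stabilizer_generators Q =
     {X_type Q (row (H_X Q) r) | r. r < dim_row (H_X Q)} \<union>
     {Z_type Q (row (H_Z Q) r) | r. r < dim_row (H_Z Q)}"

datatype logical_qubit = Left_qubit nat nat | Right_qubit nat nat

datatype logical_pauli = Logical_X logical_qubit | Logical_Z logical_qubit

definition logical_qubits :: "hgp \<Rightarrow> logical_qubit set" where
  "logical_qubits Q =
     {Left_qubit i h | i h. i \<in> piv_a Q \<and> h \<in> piv_b Q} \<union>
     {Right_qubit j l | j l. j \<in> piv_at Q \<and> l \<in> piv_bt Q}"

definition logical_paulis :: "hgp \<Rightarrow> logical_pauli set" where
  "logical_paulis Q = Logical_X ` logical_qubits Q \<union> Logical_Z ` logical_qubits Q"

fun pauli_vec :: "hgp \<Rightarrow> logical_pauli \<Rightarrow> bit vec" where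
  "pauli_vec Q (Logical_X (Left_qubit i h)) =
     X_type Q ((unit_vec (dim_col (H_a Q)) i \<otimes>\<^sub>v vec_b Q h) @\<^sub>v 0\<^sub>v (n_right Q))"
| "pauli_vec Q (Logical_Z (Left_qubit i h)) =
     Z_type Q ((vec_a Q i \<otimes>\<^sub>v unit_vec (dim_col (H_b Q)) h) @\<^sub>v 0\<^sub>v (n_right Q))"
| "pauli_vec Q (Logical_X (Right_qubit j l)) =
     X_type Q (0\<^sub>v (n_left Q) @\<^sub>v (vec_at Q j \<otimes>\<^sub>v unit_vec (dim_row (H_b Q)) l))"
| "pauli_vec Q (Logical_Z (Right_qubit j l)) =
     Z_type Q (0\<^sub>v (n_left Q) @\<^sub>v (unit_vec (dim_row (H_a Q)) j \<otimes>\<^sub>v vec_bt Q l))"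

text \<open>
  A logical (Clifford) gate is given modulo phases by its conjugation action: it sends the
  generator \<^term>\<open>P\<close> to the product of the generators in the finite set \<^term>\<open>g P\<close>. On vectors over
  the field with two elements this product is a sum.
\<close>
type_synonym logical_gate = "logical_pauli \<Rightarrow> logical_pauli set"

fun logical_hadamard :: "logical_qubit \<Rightarrow> logical_gate" where
  "logical_hadamard q (Logical_X p) = {if p = q then Logical_Z p else Logical_X p}"
| "logical_hadamard q (Logical_Z p) = {if p = q then Logical_X p else Logical_Z p}"

definition symplectic_form :: "nat \<Rightarrow> bit mat" where
  "symplectic_form n = four_block_mat (0\<^sub>m n n) (1\<^sub>m n) (1\<^sub>m n) (0\<^sub>m n n)"

definition is_symplectic_representation :: "hgp \<Rightarrow> logical_gate \<Rightarrow> bit mat \<Rightarrow> bool" where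
  "is_symplectic_representation Q g F \<longleftrightarrow>
     F \<in> carrier_mat (2 * n_qubits Q) (2 * n_qubits Q) \<and>
     F * symplectic_form (n_qubits Q) * F\<^sup>T = symplectic_form (n_qubits Q) \<and>
     (\<forall>s \<in> stabilizer_generators Q. mat_of_row s * F = mat_of_row s) \<and>
     (\<forall>P \<in> logical_paulis Q. mat_of_row (pauli_vec Q P) * F =
        mat_of_row (finsum_vec TYPE(bit) (2 * n_qubits Q) (pauli_vec Q) (g P)))"

end

theory Submission
  imports Defs
begin

text \<open>
  With \<open>t = [x, 0 | z, 0]\<close>, the sum of the vectors of the two logical Paulis of the target qubit,
  the matrix \<open>F\<close> is the symplectic transvection \<open>w \<mapsto> w + \<omega>(w, t) t\<close>, that is
  \<open>F = I + s\<^sup>T t\<close> with \<open>s = t \<Omega>\<close>. Transvections are symplectic, and they fix every vector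
  orthogonal to \<open>t\<close>. Stabilizers are orthogonal to \<open>t\<close> because \<open>a\<^sub>i\<close> and \<open>b\<^sub>h\<close> lie in the kernels of the
  check matrices; the SLT property makes the other logical Paulis orthogonal to \<open>t\<close>, while the two of
  the target qubit pair to 1 with \<open>t\<close> and are therefore exchanged.
\<close>

section \<open>Kronecker products, inner products and rows of check matrices\<close>

lemma dim_kron_vec [simp]: "dim_vec (u \<otimes>\<^sub>v v) = dim_vec u * dim_vec v"
  by (simp add: kron_vec_def)

lemma kron_vec_carrier [simp, intro]:
  "u \<in> carrier_vec m \<Longrightarrow> v \<in> carrier_vec n \<Longrightarrow> u \<otimes>\<^sub>v v \<in> carrier_vec (m * n)"
  by (auto intro: carrier_vecI)

text \<open>The range \<open>{..<m * n}\<close> splits into \<open>m\<close> consecutive blocks of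
  length \<open>n\<close>; on block \<open>i\<close> the quotient is constantly \<open>i\<close> and
  the remainder runs through \<open>{..<n}\<close>. This undoes the row-major indexing of Kronecker
  products.\<close>

lemma sum_lessThan_mult_div_mod:
  fixes f :: "nat \<Rightarrow> nat \<Rightarrow> 'a :: comm_monoid_add"
  shows "(\<Sum>k<m * n. f (k div n) (k mod n)) = (\<Sum>i<m. \<Sum>j<n. f i j)"
proof -
  have "(\<Sum>k<m * n. f (k div n) (k mod n))
      = (\<Sum>i<m. \<Sum>k = i * n..<i * n + n. f (k div n) (k mod n))"
    by (simp add: sum.nat_group)
  also have "\<dots> = (\<Sum>i<m. \<Sum>j<n. f i j)"
  proof (rule sum.cong[OF refl])
    fix i
    have "(\<Sum>k = i * n..<i * n + n. f (k div n) (k mod n))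
        = (\<Sum>j<n. f ((j + i * n) div n) ((j + i * n) mod n))"
      using sum.shift_bounds_nat_ivl[of "\<lambda>k. f (k div n) (k mod n)" 0 "i * n" n]
      by (simp add: add.commute lessThan_atLeast0)
    also have "\<dots> = (\<Sum>j<n. f i j)"
      by (rule sum.cong) auto
    finally show "(\<Sum>k = i * n..<i * n + n. f (k div n) (k mod n)) = (\<Sum>j<n. f i j)" .
  qed
  finally show ?thesis .
qed

text \<open>The source of all orthogonality relations below: a product of two inner products
  vanishes as soon as one factor does, so each sector reduces to a statement about one classical
  code.\<close>

lemma scalar_prod_kron_vec:
  fixes u v u' v' :: "'a :: comm_semiring_0 vec"
  assumes "dim_vec u = dim_vec u'" "dim_vec v = dim_vec v'"
  shows "(u \<otimes>\<^sub>v v) \<bullet> (u' \<otimes>\<^sub>v v') = (u \<bullet> u') * (v \<bullet> v')"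
proof -
  have "(u \<otimes>\<^sub>v v) \<bullet> (u' \<otimes>\<^sub>v v')
      = (\<Sum>k<dim_vec u' * dim_vec v'. (u $ (k div dim_vec v') * u' $ (k div dim_vec v'))
           * (v $ (k mod dim_vec v') * v' $ (k mod dim_vec v')))"
    using assms by (auto simp: scalar_prod_def kron_vec_def lessThan_atLeast0 ac_simps intro!: sum.cong)
  also have "\<dots> = (\<Sum>i<dim_vec u'. \<Sum>j<dim_vec v'. (u $ i * u' $ i) * (v $ j * v' $ j))"
    by (rule sum_lessThan_mult_div_mod)
  finally show ?thesis
    by (simp add: scalar_prod_def lessThan_atLeast0 sum_product)
qed

text \<open>Brings the rows of \<open>H_X\<close> and \<open>H_Z\<close> into the form to which
  \<open>scalar_prod_kron_vec\<close> applies.\<close>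

lemma row_kron_mat:
  assumes "r < dim_row A * dim_row B"
  shows "row (A \<otimes>\<^sub>m B) r = row A (r div dim_row B) \<otimes>\<^sub>v row B (r mod dim_row B)"
proof (rule eq_vecI)
  fix c assume "c < dim_vec (row A (r div dim_row B) \<otimes>\<^sub>v row B (r mod dim_row B))"
  then have c: "c < dim_col A * dim_col B" by simp
  \<comment> \<open>The bound on a remainder needs a nonzero divisor; the existence of
    \<open>c\<close> excludes an empty factor.\<close>
  then have "c mod dim_col B < dim_col B" by (cases "dim_col B") auto
  moreover have "r mod dim_row B < dim_row B" using assms by (cases "dim_row B") auto
  ultimately show "row (A \<otimes>\<^sub>m B) r $ c
      = (row A (r div dim_row B) \<otimes>\<^sub>v row B (r mod dim_row B)) $ c"
    using assms c by (simp add: kron_mat_def kron_vec_def less_mult_imp_div_less)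
qed (simp add: kron_mat_def)

lemma dim_kron_mat [simp]:
  "dim_row (A \<otimes>\<^sub>m B) = dim_row A * dim_row B"
  "dim_col (A \<otimes>\<^sub>m B) = dim_col A * dim_col B"
  by (simp_all add: kron_mat_def)

lemma dim_append_cols [simp]:
  assumes "dim_row A = dim_row B"
  shows "dim_row (A @\<^sub>c B) = dim_row B" "dim_col (A @\<^sub>c B) = dim_col A + dim_col B"
  using assms by (simp_all add: append_cols_def append_rows_def)

lemma row_append_cols:
  assumes "dim_row A = dim_row B" "r < dim_row B"
  shows "row (A @\<^sub>c B) r = row A r @\<^sub>v row B r"
  using assms by (intro eq_vecI) (auto simp: append_cols_def append_rows_def)

section \<open>Outer products and rank-one updates of the identity\<close>

lemma outer_prod_carrier [simp, intro]:
  "u \<in> carrier_vec m \<Longrightarrow> v \<in> carrier_vec n \<Longrightarrow> outer_prod u v \<in> carrier_mat m n"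
  by (auto simp: outer_prod_def)

lemma dim_outer_prod [simp]:
  "dim_row (outer_prod u v) = dim_vec u" "dim_col (outer_prod u v) = dim_vec v"
  by (simp_all add: outer_prod_def)

lemma index_outer_prod [simp]:
  "i < dim_vec u \<Longrightarrow> j < dim_vec v \<Longrightarrow> outer_prod u v $$ (i, j) = u $ i * v $ j"
  by (simp add: outer_prod_def scalar_prod_def)

text \<open>By associativity the product of the row \<open>w\<close> with the column
  \<open>s\<close> is formed first, which leaves a scalar multiple of \<open>t\<close>. Vectors
  orthogonal to \<open>s\<close> are therefore fixed.\<close>

lemma mat_of_row_mult_one_plus_outer_prod:
  fixes w s t :: "'a :: comm_semiring_1 vec"
  assumes w: "w \<in> carrier_vec n" and s: "s \<in> carrier_vec n" and t: "t \<in> carrier_vec n"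
  shows "mat_of_row w * (1\<^sub>m n + outer_prod s t) = mat_of_row (w + (w \<bullet> s) \<cdot>\<^sub>v t)"
proof -
  have "mat_of_row w * outer_prod s t = mat_of_row ((w \<bullet> s) \<cdot>\<^sub>v t)"
  proof (rule eq_matI)
    fix i j assume "i < dim_row (mat_of_row ((w \<bullet> s) \<cdot>\<^sub>v t))" "j < dim_col (mat_of_row ((w \<bullet> s) \<cdot>\<^sub>v t))"
    then show "(mat_of_row w * outer_prod s t) $$ (i, j) = mat_of_row ((w \<bullet> s) \<cdot>\<^sub>v t) $$ (i, j)"
      using w s t by (auto simp: scalar_prod_def sum_distrib_right mult.assoc intro!: sum.cong)
  qed (use t in auto)
  moreover have "mat_of_row w * (1\<^sub>m n + outer_prod s t)
      = mat_of_row w * 1\<^sub>m n + mat_of_row w * outer_prod s t"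
    using w s t by (intro mult_add_distrib_mat[of _ 1 n _ n]) auto
  ultimately show ?thesis
    using w t by (auto intro!: eq_matI)
qed

section \<open>The symplectic form and its transvections\<close>

lemma bit_add_self_mat:
  fixes M :: "bit mat"
  assumes "M \<in> carrier_mat m n"
  shows "M + M = 0\<^sub>m m n"
  using assms by (intro eq_matI) auto

text \<open>The lower blocks have no rows. A single row thus becomes a block matrix, and the rule
  for products of block matrices applies to it.\<close>

lemma mat_of_row_append_vec:
  assumes "p \<in> carrier_vec m" "q \<in> carrier_vec n"
  shows "mat_of_row (p @\<^sub>v q)
    = four_block_mat (mat_of_row p) (mat_of_row q) (0\<^sub>m 0 m) (0\<^sub>m 0 n)"
  using assms by (intro eq_matI) auto

lemma mat_of_row_mult_symplectic_form:
  assumes "p \<in> carrier_vec n" "q \<in> carrier_vec n"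
  shows "mat_of_row (p @\<^sub>v q) * symplectic_form n = mat_of_row (q @\<^sub>v p)"
proof -
  have p: "mat_of_row p \<in> carrier_mat 1 n" and q: "mat_of_row q \<in> carrier_mat 1 n"
    using assms by auto
  show ?thesis
    unfolding symplectic_form_def mat_of_row_append_vec[OF assms] mat_of_row_append_vec[OF assms(2,1)]
    by (subst mult_four_block_mat[OF p q zero_carrier_mat zero_carrier_mat
          zero_carrier_mat one_carrier_mat one_carrier_mat zero_carrier_mat])
      (simp add: left_add_zero_mat[OF q] right_add_zero_mat[OF p] right_mult_zero_mat[OF p]
        right_mult_zero_mat[OF q] right_mult_one_mat[OF p] right_mult_one_mat[OF q] del: One_nat_def)
qed

lemma symplectic_form_carrier [simp]: "symplectic_form n \<in> carrier_mat (2 * n) (2 * n)"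
  using four_block_carrier_mat[of "0\<^sub>m n n" n n "0\<^sub>m n n" n n]
  by (simp add: symplectic_form_def mult_2)

lemma transpose_symplectic_form: "(symplectic_form n)\<^sup>T = symplectic_form n"
  unfolding symplectic_form_def
  by (subst transpose_four_block_mat[of _ n n _ n _ n]) auto

text \<open>With \<open>S\<close> and \<open>T\<close> the rows below, expanding
  \<open>F * G * F\<^sup>T\<close> gives \<open>G\<close>, two copies of
  \<open>S\<^sup>T * S\<close> that cancel in characteristic 2, and a term containing
  \<open>S * T\<^sup>T\<close>, which is zero.\<close>

lemma symplectic_transvection:
  fixes p q :: "bit vec"
  assumes p: "p \<in> carrier_vec n" and q: "q \<in> carrier_vec n"
  defines "F \<equiv> 1\<^sub>m (2 * n) + outer_prod (q @\<^sub>v p) (p @\<^sub>v q)"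
  shows "F * symplectic_form n * F\<^sup>T = symplectic_form n"
proof -
  define S T G N where "S = mat_of_row (q @\<^sub>v p)" "T = mat_of_row (p @\<^sub>v q)"
    "G = symplectic_form n" "N = 2 * n"
  note defs = this
  have S: "S \<in> carrier_mat 1 N" and T: "T \<in> carrier_mat 1 N" and G: "G \<in> carrier_mat N N"
    using p q symplectic_form_carrier[of n] by (auto simp: defs mult_2)
  have St: "S\<^sup>T \<in> carrier_mat N 1" and Tt: "T\<^sup>T \<in> carrier_mat N 1"
    using S T by auto
  have TG: "T * G = S" using mat_of_row_mult_symplectic_form[OF p q] by (simp add: defs)
  have GT: "G * T\<^sup>T = S\<^sup>T"
    using transpose_mult[OF T G, unfolded TG] by (simp add: defs(3) transpose_symplectic_form)
  \<comment> \<open>The form is alternating: its value at \<open>(t, t)\<close> is the inner product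
    of \<open>p\<close> and \<open>q\<close> counted twice.\<close>
  have ST: "S * T\<^sup>T = 0\<^sub>m 1 1"
  proof (rule eq_matI)
    fix i j :: nat assume "i < dim_row (0\<^sub>m 1 1 :: bit mat)" "j < dim_col (0\<^sub>m 1 1 :: bit mat)"
    moreover have "(q @\<^sub>v p) \<bullet> (p @\<^sub>v q) = 0"
      using p q by (simp add: scalar_prod_append[of _ n _ n] comm_scalar_prod[OF p q])
    ultimately show "(S * T\<^sup>T) $$ (i, j) = 0\<^sub>m 1 1 $$ (i, j)"
      using p q by (simp add: defs)
  qed (use S T in auto)
  have F: "F = 1\<^sub>m N + S\<^sup>T * T" by (simp add: F_def outer_prod_def defs)
  have Ft: "F\<^sup>T = 1\<^sub>m N + T\<^sup>T * S"
    unfolding F using S T by (simp add: transpose_add[of _ N N] transpose_mult[OF St T])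
  have SS: "S\<^sup>T * S \<in> carrier_mat N N" and TS: "T\<^sup>T * S \<in> carrier_mat N N"
    and ST': "S\<^sup>T * T \<in> carrier_mat N N" using S T by auto
  have "F * G = G + S\<^sup>T * S"
    unfolding F using G S T ST' TG
    by (simp add: add_mult_distrib_mat[OF one_carrier_mat ST' G] assoc_mult_mat[OF St T G])
  then have "F * G * F\<^sup>T = (G + S\<^sup>T * S) * (1\<^sub>m N + T\<^sup>T * S)" by (simp only: Ft)
  also have "\<dots> = (G + S\<^sup>T * S) + (G + S\<^sup>T * S) * (T\<^sup>T * S)"
    using G SS TS by (subst mult_add_distrib_mat[of _ N N _ N]) auto
  also have "(G + S\<^sup>T * S) * (T\<^sup>T * S) = G * (T\<^sup>T * S) + S\<^sup>T * S * (T\<^sup>T * S)"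
    by (rule add_mult_distrib_mat[OF G SS TS])
  also have "G * (T\<^sup>T * S) = S\<^sup>T * S"
    using assoc_mult_mat[OF G Tt S] by (simp add: GT)
  also have "S\<^sup>T * S * (T\<^sup>T * S) = S\<^sup>T * (S * T\<^sup>T * S)"
    using assoc_mult_mat[OF St S TS] assoc_mult_mat[OF S Tt S] by simp
  also have "\<dots> = 0\<^sub>m N N"
    unfolding ST using S St by simp
  also have "(G + S\<^sup>T * S) + (S\<^sup>T * S + 0\<^sub>m N N) = G + (S\<^sup>T * S + S\<^sup>T * S)"
    using G SS by (simp add: assoc_add_mat[of _ N N])
  also have "\<dots> = G" using G by (simp add: bit_add_self_mat[OF SS])
  finally show ?thesis by (simp only: defs)
qed

section \<open>Block form of the transvection matrix\<close>

lemma outer_prod_append_vec: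
  "outer_prod (u @\<^sub>v u') (v @\<^sub>v v')
    = four_block_mat (outer_prod u v) (outer_prod u v') (outer_prod u' v) (outer_prod u' v')"
  by (intro eq_matI) auto

lemma outer_prod_zero [simp]:
  "outer_prod u (0\<^sub>v n) = 0\<^sub>m (dim_vec u) n"
  "outer_prod (0\<^sub>v n) u = 0\<^sub>m n (dim_vec u)"
  by (intro eq_matI; simp)+

lemma one_mat_add_size:
  "1\<^sub>m (m + n) = four_block_mat (1\<^sub>m m) (0\<^sub>m m n) (0\<^sub>m n m) (1\<^sub>m n)"
  by (intro eq_matI) auto

text \<open>Links the displayed matrix to the transvection. The zero padding on the right sector
  confines the rank-one term to the left-sector blocks, and the identity contributes only to the
  diagonal blocks of both levels.\<close>

lemma four_block_transvection:
  fixes x z :: "'a :: comm_ring_1 vec"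
  assumes x: "x \<in> carrier_vec n" and z: "z \<in> carrier_vec n"
  shows "four_block_mat
      (four_block_mat (1\<^sub>m n + outer_prod z x) (0\<^sub>m n m) (0\<^sub>m m n) (1\<^sub>m m))
      (four_block_mat (outer_prod z z) (0\<^sub>m n m) (0\<^sub>m m n) (0\<^sub>m m m))
      (four_block_mat (outer_prod x x) (0\<^sub>m n m) (0\<^sub>m m n) (0\<^sub>m m m))
      (four_block_mat (1\<^sub>m n + outer_prod x z) (0\<^sub>m n m) (0\<^sub>m m n) (1\<^sub>m m))
    = 1\<^sub>m (2 * (n + m))
      + outer_prod ((z @\<^sub>v 0\<^sub>v m) @\<^sub>v (x @\<^sub>v 0\<^sub>v m)) ((x @\<^sub>v 0\<^sub>v m) @\<^sub>v (z @\<^sub>v 0\<^sub>v m))"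
    (is "?L = ?R")
proof -
  have outer: "outer_prod (u @\<^sub>v 0\<^sub>v m) (v @\<^sub>v 0\<^sub>v m)
      = four_block_mat (outer_prod u v) (0\<^sub>m n m) (0\<^sub>m m n) (0\<^sub>m m m)"
    if "u \<in> carrier_vec n" "v \<in> carrier_vec n" for u v :: "'a vec"
    using that by (simp add: outer_prod_append_vec)
  have diag: "1\<^sub>m (n + m) + four_block_mat M (0\<^sub>m n m) (0\<^sub>m m n) (0\<^sub>m m m)
      = four_block_mat (1\<^sub>m n + M) (0\<^sub>m n m) (0\<^sub>m m n) (1\<^sub>m m)"
    if "M \<in> carrier_mat n n" for M :: "'a mat"
    using that unfolding one_mat_add_size
    by (subst add_four_block_mat[of _ n n _ m _ m]) auto
  have carrier: "four_block_mat M (0\<^sub>m n m) (0\<^sub>m m n) (0\<^sub>m m m) \<in> carrier_mat (n + m) (n + m)"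
    if "M \<in> carrier_mat n n" for M :: "'a mat"
    using that by auto
  note outers = x z outer_prod_carrier[OF x x] outer_prod_carrier[OF x z]
    outer_prod_carrier[OF z x] outer_prod_carrier[OF z z]
  have "?R = 1\<^sub>m (n + m + (n + m)) + four_block_mat
      (four_block_mat (outer_prod z x) (0\<^sub>m n m) (0\<^sub>m m n) (0\<^sub>m m m))
      (four_block_mat (outer_prod z z) (0\<^sub>m n m) (0\<^sub>m m n) (0\<^sub>m m m))
      (four_block_mat (outer_prod x x) (0\<^sub>m n m) (0\<^sub>m m n) (0\<^sub>m m m))
      (four_block_mat (outer_prod x z) (0\<^sub>m n m) (0\<^sub>m m n) (0\<^sub>m m m))"
    by (simp only: outer_prod_append_vec[of "z @\<^sub>v 0\<^sub>v m"] outer x z mult_2)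
  also have "\<dots> = ?L"
    unfolding one_mat_add_size[of "n + m"]
    by (subst add_four_block_mat[OF one_carrier_mat zero_carrier_mat zero_carrier_mat one_carrier_mat])
      (simp_all only: carrier outers diag left_add_zero_mat[OF carrier])
  finally show ?thesis by simp
qed

section \<open>SLT bases and vectors of logical Paulis\<close>

lemma SLT_basis_pivot_less: "is_SLT_basis n W P a \<Longrightarrow> i \<in> P \<Longrightarrow> i < n"
  by (auto simp: is_SLT_basis_def)

lemma SLT_basis_index:
  "is_SLT_basis n W P a \<Longrightarrow> i \<in> P \<Longrightarrow> j \<in> P \<Longrightarrow> a i $ j = (if j = i then 1 else 0)"
  by (simp add: is_SLT_basis_def)

lemma SLT_basis_in_kernel:
  assumes "is_SLT_basis (dim_col H) (mat_kernel H) P a" "i \<in> P"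
  shows "a i \<in> mat_kernel H"
proof -
  \<comment> \<open>The kernel is made available as a vector space, whose \<open>basis_def\<close>
    says that basis vectors lie in its carrier.\<close>
  interpret kernel "dim_row H" "dim_col H" H by unfold_locales auto
  show ?thesis using assms Ker.basis_def by (auto simp: is_SLT_basis_def)
qed

lemma SLT_basis_carrier:
  assumes "is_SLT_basis (dim_col H) (mat_kernel H) P a" "i \<in> P"
  shows "a i \<in> carrier_vec (dim_col H)"
  using SLT_basis_in_kernel[OF assms] by (simp add: mat_kernel_def)

lemma Pauli_type_carrier:
  assumes "u \<in> carrier_vec (n_left Q)" "v \<in> carrier_vec (n_right Q)"
  shows "X_type Q (u @\<^sub>v v) \<in> carrier_vec (2 * n_qubits Q)"
    and "Z_type Q (u @\<^sub>v v) \<in> carrier_vec (2 * n_qubits Q)"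
  using assms by (auto simp: X_type_def Z_type_def n_qubits_def intro!: carrier_vecI)

lemma pauli_vec_carrier:
  assumes "has_SLT_bases Q" "P \<in> logical_paulis Q"
  shows "pauli_vec Q P \<in> carrier_vec (2 * n_qubits Q)"
proof -
  have "\<And>i. i \<in> piv_a Q \<Longrightarrow> vec_a Q i \<in> carrier_vec (dim_col (H_a Q))"
    and "\<And>i. i \<in> piv_b Q \<Longrightarrow> vec_b Q i \<in> carrier_vec (dim_col (H_b Q))"
    and "\<And>i. i \<in> piv_at Q \<Longrightarrow> vec_at Q i \<in> carrier_vec (dim_row (H_a Q))"
    and "\<And>i. i \<in> piv_bt Q \<Longrightarrow> vec_bt Q i \<in> carrier_vec (dim_row (H_b Q))"
    using assms(1) SLT_basis_carrier[of "H_a Q"] SLT_basis_carrier[of "H_b Q"]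
      SLT_basis_carrier[of "(H_a Q)\<^sup>T"] SLT_basis_carrier[of "(H_b Q)\<^sup>T"]
    unfolding has_SLT_bases_def by (simp_all, blast+)
  then show ?thesis
    using assms(2)
    by (auto simp: logical_paulis_def logical_qubits_def n_left_def n_right_def intro!: Pauli_type_carrier)
qed

section \<open>The transvection as the targeted logical Hadamard gate\<close>

theorem proposition4p5:
  fixes Q :: hgp and m_a n_a m_b n_b i h :: nat
  assumes "H_a Q \<in> carrier_mat m_a n_a"
    and "H_b Q \<in> carrier_mat m_b n_b"
    and "has_SLT_bases Q"
    and "Left_qubit i h \<in> logical_qubits Q"
  shows
    "let n' = n_a * n_b; m' = m_a * m_b;
         x = unit_vec n_a i \<otimes>\<^sub>v vec_b Q h;
         z = vec_a Q i \<otimes>\<^sub>v unit_vec n_b h;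
         A = 1\<^sub>m n' + outer_prod z x;
         B = outer_prod z z;
         C = outer_prod x x;
         D = 1\<^sub>m n' + outer_prod x z;
         F = four_block_mat
               (four_block_mat A (0\<^sub>m n' m') (0\<^sub>m m' n') (1\<^sub>m m'))
               (four_block_mat B (0\<^sub>m n' m') (0\<^sub>m m' n') (0\<^sub>m m' m'))
               (four_block_mat C (0\<^sub>m n' m') (0\<^sub>m m' n') (0\<^sub>m m' m'))
               (four_block_mat D (0\<^sub>m n' m') (0\<^sub>m m' n') (1\<^sub>m m'))
     in is_symplectic_representation Q (logical_hadamard (Left_qubit i h)) F"
proof -
  define n m N where "n = n_a * n_b" "m = m_a * m_b" "N = n_qubits Q"
  note sizes = this
  have dims [simp]: "dim_row (H_a Q) = m_a" "dim_col (H_a Q) = n_a"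
    "dim_row (H_b Q) = m_b" "dim_col (H_b Q) = n_b"
    using assms(1,2) by auto
  have left: "n_left Q = n" and right: "n_right Q = m" and N: "N = n + m"
    by (simp_all add: sizes n_left_def n_right_def n_qubits_def)
  have a: "is_SLT_basis n_a (mat_kernel (H_a Q)) (piv_a Q) (vec_a Q)"
    and b: "is_SLT_basis n_b (mat_kernel (H_b Q)) (piv_b Q) (vec_b Q)"
    using assms(3) by (simp_all add: has_SLT_bases_def)
  have i: "i \<in> piv_a Q" and h: "h \<in> piv_b Q"
    using assms(4) by (auto simp: logical_qubits_def)
  have a_ker: "vec_a Q j \<in> carrier_vec n_a" "H_a Q *\<^sub>v vec_a Q j = 0\<^sub>v m_a" "j < n_a"
    if "j \<in> piv_a Q" for j
    using SLT_basis_in_kernel[of "H_a Q" "piv_a Q" "vec_a Q" j] a that SLT_basis_pivot_less[OF a]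
    by (auto simp: mat_kernel_def)
  have b_ker: "vec_b Q j \<in> carrier_vec n_b" "H_b Q *\<^sub>v vec_b Q j = 0\<^sub>v m_b" "j < n_b"
    if "j \<in> piv_b Q" for j
    using SLT_basis_in_kernel[of "H_b Q" "piv_b Q" "vec_b Q" j] b that SLT_basis_pivot_less[OF b]
    by (auto simp: mat_kernel_def)
  define x z where "x = unit_vec n_a i \<otimes>\<^sub>v vec_b Q h" "z = vec_a Q i \<otimes>\<^sub>v unit_vec n_b h"
  note xz_def = this
  have x: "x \<in> carrier_vec n" and z: "z \<in> carrier_vec n"
    using a_ker[OF i] b_ker[OF h] by (auto simp: xz_def sizes)
  \<comment> \<open>\<open>p\<close> and \<open>q\<close> are \<open>x\<close> and \<open>z\<close>
    extended by zero to all qubits, and \<open>s\<close> is \<open>t\<close> with its halves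
    swapped, so that \<open>w \<bullet> s\<close> is the symplectic product of \<open>w\<close> with
    \<open>t\<close>.\<close>
  define p q t s where "p = x @\<^sub>v 0\<^sub>v m" "q = z @\<^sub>v 0\<^sub>v m" "t = p @\<^sub>v q" "s = q @\<^sub>v p"
  note pq_def = this
  have p: "p \<in> carrier_vec N" and q: "q \<in> carrier_vec N"
    using x z by (auto simp: pq_def N)
  have t: "t \<in> carrier_vec (2 * N)" and s: "s \<in> carrier_vec (2 * N)"
    using p q by (auto simp: pq_def(3,4) mult_2)
  define F where "F = 1\<^sub>m (2 * N) + outer_prod s t"
  have F: "F \<in> carrier_mat (2 * N) (2 * N)" using s t by (auto simp: F_def)
  have act: "mat_of_row w * F = mat_of_row (w + (w \<bullet> s) \<cdot>\<^sub>v t)" if "w \<in> carrier_vec (2 * N)" for w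
    unfolding F_def using that s t by (rule mat_of_row_mult_one_plus_outer_prod)
  \<comment> \<open>The swap in \<open>s\<close> pairs X-parts with \<open>z\<close> and Z-parts
    with \<open>x\<close>; the component \<open>v\<close> on the right sector meets only
    zeros.\<close>
  have X_dot: "X_type Q (u @\<^sub>v v) \<bullet> s = u \<bullet> z" and Z_dot: "Z_type Q (u @\<^sub>v v) \<bullet> s = u \<bullet> x"
    if "u \<in> carrier_vec n" "v \<in> carrier_vec m" for u v
  proof -
    have "u @\<^sub>v v \<in> carrier_vec N" using that by (auto simp: N)
    then show "X_type Q (u @\<^sub>v v) \<bullet> s = u \<bullet> z" "Z_type Q (u @\<^sub>v v) \<bullet> s = u \<bullet> x"
      using that x z p q unfolding X_type_def Z_type_def pq_def(4) sizes(3)[symmetric]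
      by (simp_all add: scalar_prod_append[of _ N _ N], simp_all add: pq_def scalar_prod_append[of _ n _ m])
  qed
  have stab: "mat_of_row w * F = mat_of_row w" if "w \<in> stabilizer_generators Q" for w
  proof -
    have "w \<in> carrier_vec (2 * N) \<and> w \<bullet> s = 0"
      using that unfolding stabilizer_generators_def
    proof (elim UnE CollectE exE conjE)
      fix r assume w: "w = X_type Q (row (H_X Q) r)" and "r < dim_row (H_X Q)"
      then have r: "r < m_a * n_b" by (simp add: H_X_def)
      then have d: "r div n_b < m_a" "r mod n_b < n_b"
        by (auto simp: less_mult_imp_div_less) (cases n_b; simp)
      \<comment> \<open>The two sector components of row \<open>r\<close>. In both blocks of
        \<open>H_X Q\<close> the second Kronecker factor has \<open>n_b\<close> rows, hence the
        common quotient and remainder.\<close>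
      define u v where "u = row (H_a Q) (r div n_b) \<otimes>\<^sub>v unit_vec n_b (r mod n_b)"
        and "v = unit_vec m_a (r div n_b) \<otimes>\<^sub>v row (H_b Q)\<^sup>T (r mod n_b)"
      have rw: "row (H_X Q) r = u @\<^sub>v v"
        using r d by (simp add: H_X_def row_append_cols row_kron_mat u_def v_def)
      have u: "u \<in> carrier_vec n" and v: "v \<in> carrier_vec m"
        unfolding u_def v_def sizes by (intro kron_vec_carrier carrier_vecI; simp)+
      \<comment> \<open>This is an entry of a zero vector, because \<open>vec_a Q i\<close> lies in
        the kernel of \<open>H_a Q\<close>; it is one of the two factors of
        \<open>u \<bullet> z\<close>.\<close>
      have "row (H_a Q) (r div n_b) \<bullet> vec_a Q i = (H_a Q *\<^sub>v vec_a Q i) $ (r div n_b)"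
        using d by simp
      then have "u \<bullet> z = 0"
        using a_ker[OF i] d by (simp add: u_def v_def xz_def scalar_prod_kron_vec)
      then show ?thesis using X_dot[OF u v] Pauli_type_carrier[of u Q v] u v
        by (simp add: w rw left right sizes(3))
    next
      fix r assume w: "w = Z_type Q (row (H_Z Q) r)" and "r < dim_row (H_Z Q)"
      then have r: "r < n_a * m_b" by (simp add: H_Z_def)
      then have d: "r div m_b < n_a" "r mod m_b < m_b"
        by (auto simp: less_mult_imp_div_less) (cases m_b; simp)
      define u v where "u = unit_vec n_a (r div m_b) \<otimes>\<^sub>v row (H_b Q) (r mod m_b)"
        and "v = row (H_a Q)\<^sup>T (r div m_b) \<otimes>\<^sub>v unit_vec m_b (r mod m_b)"
      have rw: "row (H_Z Q) r = u @\<^sub>v v"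
        using r d by (simp add: H_Z_def row_append_cols row_kron_mat u_def v_def)
      have u: "u \<in> carrier_vec n" and v: "v \<in> carrier_vec m"
        unfolding u_def v_def sizes by (intro kron_vec_carrier carrier_vecI; simp)+
      \<comment> \<open>Here the kernel of \<open>H_b Q\<close> makes the other Kronecker factor
        vanish.\<close>
      have "row (H_b Q) (r mod m_b) \<bullet> vec_b Q h = (H_b Q *\<^sub>v vec_b Q h) $ (r mod m_b)"
        using d by simp
      then have "u \<bullet> x = 0"
        using b_ker[OF h] d by (simp add: u_def v_def xz_def scalar_prod_kron_vec)
      then show ?thesis using Z_dot[OF u v] Pauli_type_carrier[of u Q v] u v
        by (simp add: w rw left right sizes(3))
    qed
    then show ?thesis using act[of w] t by auto
  qed
  define g where "g = logical_hadamard (Left_qubit i h)"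
  have paulis: "mat_of_row (pauli_vec Q P) * F
      = mat_of_row (finsum_vec TYPE(bit) (2 * N) (pauli_vec Q) (g P))"
    if P: "P \<in> logical_paulis Q" for P
  proof -
    \<comment> \<open>The Hadamard gate sends each generator to a single generator, so the
      prescribed image is one vector \<open>pauli_vec Q P'\<close>.\<close>
    have "\<exists>P' \<in> logical_paulis Q. g P = {P'} \<and>
        pauli_vec Q P + (pauli_vec Q P \<bullet> s) \<cdot>\<^sub>v t = pauli_vec Q P'"
    proof -
      have cases: "(\<exists>i' h'. i' \<in> piv_a Q \<and> h' \<in> piv_b Q \<and>
          (P = Logical_X (Left_qubit i' h') \<or> P = Logical_Z (Left_qubit i' h'))) \<or>
        (\<exists>j l. j \<in> piv_at Q \<and> l \<in> piv_bt Q \<and>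
          (P = Logical_X (Right_qubit j l) \<or> P = Logical_Z (Right_qubit j l)))"
        using P by (auto simp: logical_paulis_def logical_qubits_def)
      \<comment> \<open>Adding \<open>t\<close> cancels the half already present and inserts the
        other one, since 1 + 1 = 0.\<close>
      have X_t: "X_type Q p + t = Z_type Q q" and Z_t: "Z_type Q q + t = X_type Q p"
        using p q unfolding X_type_def Z_type_def pq_def(3) sizes(3)[symmetric]
        by (auto intro!: eq_vecI)
      have fixed: "w + (w \<bullet> s) \<cdot>\<^sub>v t = w" if "w \<in> carrier_vec (2 * N)" "w \<bullet> s = 0" for w
        using that t by auto
      have carrier: "pauli_vec Q P \<in> carrier_vec (2 * N)"
        using pauli_vec_carrier[OF assms(3) P] by (simp add: sizes)
      have left_P: "Logical_X (Left_qubit i h) \<in> logical_paulis Q"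
        "Logical_Z (Left_qubit i h) \<in> logical_paulis Q"
        using assms(4) by (auto simp: logical_paulis_def)
      have X_ih: "pauli_vec Q (Logical_X (Left_qubit i h)) = X_type Q p"
        and Z_ih: "pauli_vec Q (Logical_Z (Left_qubit i h)) = Z_type Q q"
        by (simp_all add: pq_def xz_def right)
      \<comment> \<open>The unit vectors select entries of basis vectors at pivots, so the SLT
        property makes each factor a Kronecker delta.\<close>
      have x_z: "(unit_vec n_a i' \<otimes>\<^sub>v vec_b Q h') \<bullet> z = (if i' = i \<and> h' = h then 1 else 0)"
        and z_x: "(vec_a Q i' \<otimes>\<^sub>v unit_vec n_b h') \<bullet> x = (if i' = i \<and> h' = h then 1 else 0)"
        if "i' \<in> piv_a Q" "h' \<in> piv_b Q" for i' h'
        using a_ker[OF that(1)] b_ker[OF that(2)] a_ker[OF i] b_ker[OF h]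
          SLT_basis_index[OF a] SLT_basis_index[OF b] i h that
        by (auto simp: xz_def scalar_prod_kron_vec)
      from cases show ?thesis
      proof (elim disjE exE conjE)
        fix i' h' assume ih: "i' \<in> piv_a Q" "h' \<in> piv_b Q" and P_eq: "P = Logical_X (Left_qubit i' h')"
        have "pauli_vec Q P \<bullet> s = (if i' = i \<and> h' = h then 1 else 0)"
          using X_dot[of "unit_vec n_a i' \<otimes>\<^sub>v vec_b Q h'" "0\<^sub>v m"] x_z[OF ih] a_ker[OF ih(1)] b_ker[OF ih(2)]
          by (simp add: P_eq right sizes(1))
        then show ?thesis
          using fixed[OF carrier] P left_P X_ih Z_ih X_t
          by (cases "i' = i \<and> h' = h") (auto simp: P_eq g_def)
      next
        fix i' h' assume ih: "i' \<in> piv_a Q" "h' \<in> piv_b Q" and P_eq: "P = Logical_Z (Left_qubit i' h')"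
        have "pauli_vec Q P \<bullet> s = (if i' = i \<and> h' = h then 1 else 0)"
          using Z_dot[of "vec_a Q i' \<otimes>\<^sub>v unit_vec n_b h'" "0\<^sub>v m"] z_x[OF ih] a_ker[OF ih(1)] b_ker[OF ih(2)]
          by (simp add: P_eq right sizes(1))
        then show ?thesis
          using fixed[OF carrier] P left_P X_ih Z_ih Z_t
          by (cases "i' = i \<and> h' = h") (auto simp: P_eq g_def)
      next
        fix j l assume jl: "j \<in> piv_at Q" "l \<in> piv_bt Q" and P_eq: "P = Logical_X (Right_qubit j l)"
        \<comment> \<open>For right-sector qubits only the length of the vector matters: its left
          component is zero, so it is orthogonal to \<open>s\<close> and fixed, as the gate
          requires.\<close>
        have "vec_at Q j \<in> carrier_vec m_a"
          using SLT_basis_carrier[of "(H_a Q)\<^sup>T" "piv_at Q" "vec_at Q"] assms(3) jl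
          by (simp add: has_SLT_bases_def)
        then have "pauli_vec Q P \<bullet> s = 0"
          using X_dot[of "0\<^sub>v n" "vec_at Q j \<otimes>\<^sub>v unit_vec m_b l"] z
          by (simp add: P_eq left sizes(2))
        then show ?thesis
          using fixed[OF carrier] P by (auto simp: P_eq g_def)
      next
        fix j l assume jl: "j \<in> piv_at Q" "l \<in> piv_bt Q" and P_eq: "P = Logical_Z (Right_qubit j l)"
        have "vec_bt Q l \<in> carrier_vec m_b"
          using SLT_basis_carrier[of "(H_b Q)\<^sup>T" "piv_bt Q" "vec_bt Q"] assms(3) jl
          by (simp add: has_SLT_bases_def)
        then have "pauli_vec Q P \<bullet> s = 0"
          using Z_dot[of "0\<^sub>v n" "unit_vec m_a j \<otimes>\<^sub>v vec_bt Q l"] x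
          by (simp add: P_eq left sizes(2))
        then show ?thesis
          using fixed[OF carrier] P by (auto simp: P_eq g_def)
      qed
    qed
    then obtain P' where P': "P' \<in> logical_paulis Q" "g P = {P'}"
      "pauli_vec Q P + (pauli_vec Q P \<bullet> s) \<cdot>\<^sub>v t = pauli_vec Q P'" by blast
    \<comment> \<open>The sum over a singleton is evaluated by inserting \<open>P'\<close> into the
      empty set.\<close>
    have "finsum_vec TYPE(bit) (2 * N) (pauli_vec Q) {P'} = pauli_vec Q P' + 0\<^sub>v (2 * N)"
      using pauli_vec_carrier[OF assms(3) P'(1)]
      by (subst finsum_vec_insert) (auto simp: finsum_vec_empty sizes)
    then show ?thesis
      using pauli_vec_carrier[OF assms(3)] P P' act by (simp add: sizes)
  qed
  have "is_symplectic_representation Q g F"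
    unfolding is_symplectic_representation_def sizes(3)[symmetric]
    using F stab paulis symplectic_transvection[OF p q]
    by (simp add: F_def pq_def(3,4))
  then show ?thesis
    \<comment> \<open>The abbreviations in the carrier facts are unfolded so that the rule matches
      the matrix literally as displayed.\<close>
    unfolding Let_def four_block_transvection[OF x[unfolded xz_def sizes] z[unfolded xz_def sizes]]
    by (simp add: F_def pq_def xz_def N sizes(1,2) g_def)
qed

end
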